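(* Let $S$ be a $\Gamma$-semigroup. The following are equivalent: (1) $S$ is left regular; (2) for every fuzzy left ideal $\mu$ of $S$ and every $a\in S$ there exists $\gamma\in\Gamma$ such that $\mu(a)=\mu(a\gamma a)$. Likewise, the following are equivalent: (1') $S$ is right regular; (2') for every fuzzy right ideal $\mu$ of $S$ and every $a\in S$ there exists $\gamma\in\Gamma$ such that $\mu(a)=\mu(a\gamma a)$.
   Context: Let $S$ and $\Gamma$ be non-empty sets. $S$ is a $\Gamma$-semigroup if there is a map $S\times\Gamma\times S\to S$, written $(a,\alpha,b)\mapsto a\alpha b$, with $(x\beta y)\gamma z=x\beta(y\gamma z)$ for all $x,y,z\in S$, $\beta,\gamma\in\Gamma$. $S$ is left regular (respectively right regular) if for each $a\in S$ there exist $x\in S$ and $\alpha,\beta\in\Gamma$ with $a=x\alpha a\beta a$ (respectively $a=a\beta a\alpha x$). A fuzzy subset of $S$ is a function $\mu:S\to[0,1]$; it is non-empty if it is not identically $0$. A non-empty fuzzy subset $\mu$ is a fuzzy left ideal if $\mu(x\gamma y)\ge\mu(y)$ for all $x,y\in S,\gamma\in\Gamma$, and a fuzzy right ideal if $\mu(x\gamma y)\ge\mu(x)$ for all $x,y\in S,\gamma\in\Gamma$. *)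

theory Defs
  imports Complex_Main "HOL-Library.FuncSet"
begin

locale gamma_semigroup =
  fixes S :: "'a set" and \<Gamma> :: "'g set" and m :: "'a \<Rightarrow> 'g \<Rightarrow> 'a \<Rightarrow> 'a"
  assumes S_nonempty: "S \<noteq> {}"
    and Gamma_nonempty: "\<Gamma> \<noteq> {}"
    and closed: "\<lbrakk>a \<in> S; \<alpha> \<in> \<Gamma>; b \<in> S\<rbrakk> \<Longrightarrow> m a \<alpha> b \<in> S"
    and assoc: "\<lbrakk>x \<in> S; y \<in> S; z \<in> S; \<beta> \<in> \<Gamma>; \<gamma> \<in> \<Gamma>\<rbrakk>
      \<Longrightarrow> m (m x \<beta> y) \<gamma> z = m x \<beta> (m y \<gamma> z)"

(* In the two definitions below the unbracketed products x \<alpha> a \<beta> a and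
   a \<beta> a \<alpha> x are bracketed to the left; associativity makes this immaterial. *)

definition left_regular :: "'a set \<Rightarrow> 'g set \<Rightarrow> ('a \<Rightarrow> 'g \<Rightarrow> 'a \<Rightarrow> 'a) \<Rightarrow> bool" where
  "left_regular S \<Gamma> m \<longleftrightarrow>
    (\<forall>a\<in>S. \<exists>x\<in>S. \<exists>\<alpha>\<in>\<Gamma>. \<exists>\<beta>\<in>\<Gamma>. a = m (m x \<alpha> a) \<beta> a)"

definition right_regular :: "'a set \<Rightarrow> 'g set \<Rightarrow> ('a \<Rightarrow> 'g \<Rightarrow> 'a \<Rightarrow> 'a) \<Rightarrow> bool" where
  "right_regular S \<Gamma> m \<longleftrightarrow>
    (\<forall>a\<in>S. \<exists>x\<in>S. \<exists>\<alpha>\<in>\<Gamma>. \<exists>\<beta>\<in>\<Gamma>. a = m (m a \<beta> a) \<alpha> x)"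

(* A fuzzy subset is a total HOL function of which only the values on S matter. *)

definition fuzzy_subset :: "'a set \<Rightarrow> ('a \<Rightarrow> real) \<Rightarrow> bool" where
  "fuzzy_subset S \<mu> \<longleftrightarrow> \<mu> \<in> S \<rightarrow> {0..1}"

definition fuzzy_nonempty :: "'a set \<Rightarrow> ('a \<Rightarrow> real) \<Rightarrow> bool" where
  "fuzzy_nonempty S \<mu> \<longleftrightarrow> \<not> (\<forall>x\<in>S. \<mu> x = 0)"

definition fuzzy_left_ideal ::
    "'a set \<Rightarrow> 'g set \<Rightarrow> ('a \<Rightarrow> 'g \<Rightarrow> 'a \<Rightarrow> 'a) \<Rightarrow> ('a \<Rightarrow> real) \<Rightarrow> bool" where
  "fuzzy_left_ideal S \<Gamma> m \<mu> \<longleftrightarrow> fuzzy_subset S \<mu> \<and> fuzzy_nonempty S \<mu> \<and>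
    (\<forall>x\<in>S. \<forall>y\<in>S. \<forall>\<gamma>\<in>\<Gamma>. \<mu> (m x \<gamma> y) \<ge> \<mu> y)"

definition fuzzy_right_ideal ::
    "'a set \<Rightarrow> 'g set \<Rightarrow> ('a \<Rightarrow> 'g \<Rightarrow> 'a \<Rightarrow> 'a) \<Rightarrow> ('a \<Rightarrow> real) \<Rightarrow> bool" where
  "fuzzy_right_ideal S \<Gamma> m \<mu> \<longleftrightarrow> fuzzy_subset S \<mu> \<and> fuzzy_nonempty S \<mu> \<and>
    (\<forall>x\<in>S. \<forall>y\<in>S. \<forall>\<gamma>\<in>\<Gamma>. \<mu> (m x \<gamma> y) \<ge> \<mu> x)"

end

(* If a = x \<alpha> a \<beta> a, a fuzzy left ideal satisfies \<mu> a \<ge> \<mu> (a \<beta> a) \<ge> \<mu> a. Conversely, the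
   element \<gamma> provided by (2) depends on \<mu>, so (2) is applied to the indicator function of
   the left ideal generated by all the squares a \<beta> a at once; it puts a into that ideal.
   The right-handed equivalence is the left-handed one for the opposite product. *)

theory Submission
  imports Defs
begin

context gamma_semigroup
begin

lemma fuzzy_left_ideal_square_eq:
  assumes "left_regular S \<Gamma> m" and \<mu>: "fuzzy_left_ideal S \<Gamma> m \<mu>" and a: "a \<in> S"
  shows "\<exists>\<gamma>\<in>\<Gamma>. \<mu> a = \<mu> (m a \<gamma> a)"
proof -
  obtain x \<alpha> \<beta> where x: "x \<in> S" "\<alpha> \<in> \<Gamma>" "\<beta> \<in> \<Gamma>" and "a = m (m x \<alpha> a) \<beta> a"
    using assms(1) a unfolding left_regular_def by blast
  \<comment> \<open>Regrouping shows \<open>a\<close> as a left multiple of its own square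
    \<open>m a \<beta> a\<close>, so the left ideal inequality bounds \<mu> at the square by \<mu>
    at \<open>a\<close>.\<close>
  then have eq: "m x \<alpha> (m a \<beta> a) = a"
    using assoc a by metis
  have "\<mu> a \<le> \<mu> (m a \<beta> a)"
    using \<mu> a x unfolding fuzzy_left_ideal_def by blast
  moreover have "\<mu> (m a \<beta> a) \<le> \<mu> (m x \<alpha> (m a \<beta> a))"
    using \<mu> a x closed unfolding fuzzy_left_ideal_def by blast
  ultimately show ?thesis
    using eq x by (metis antisym)
qed

text \<open>Turns an ordinary left ideal into a fuzzy one. Closure under left multiplication makes
  the value 1 persist, every other value is 0, and \<open>L \<noteq> {}\<close> keeps the indicator
  from vanishing identically.\<close>

lemma fuzzy_left_ideal_indicator:
  assumes "L \<subseteq> S" "L \<noteq> {}"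
    and "\<And>x y \<gamma>. \<lbrakk>x \<in> S; y \<in> L; \<gamma> \<in> \<Gamma>\<rbrakk> \<Longrightarrow> m x \<gamma> y \<in> L"
  shows "fuzzy_left_ideal S \<Gamma> m (\<lambda>y. if y \<in> L then 1 else 0)"
  using assms
  unfolding fuzzy_left_ideal_def fuzzy_subset_def fuzzy_nonempty_def by auto

lemma left_regularI:
  assumes sq: "\<And>\<mu> a. \<lbrakk>fuzzy_left_ideal S \<Gamma> m \<mu>; a \<in> S\<rbrakk> \<Longrightarrow> \<exists>\<gamma>\<in>\<Gamma>. \<mu> a = \<mu> (m a \<gamma> a)"
  shows "left_regular S \<Gamma> m"
  unfolding left_regular_def
proof
  fix a assume a: "a \<in> S"
  define Q where "Q = {m a \<beta> a |\<beta>. \<beta> \<in> \<Gamma>}"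
  \<comment> \<open>\<open>Q\<close> is adjoined explicitly: without an identity, a square need not
    be a left multiple of a square.\<close>
  define L where "L = Q \<union> {m x \<alpha> q |x \<alpha> q. x \<in> S \<and> \<alpha> \<in> \<Gamma> \<and> q \<in> Q}"
  have QS: "Q \<subseteq> S"
    unfolding Q_def using a closed by blast
  have "fuzzy_left_ideal S \<Gamma> m (\<lambda>y. if y \<in> L then 1 else 0)"
  proof (rule fuzzy_left_ideal_indicator)
    show "L \<subseteq> S"
      unfolding L_def using QS closed by blast
    show "L \<noteq> {}"
      unfolding L_def Q_def using Gamma_nonempty by blast
    fix x y \<gamma> assume x: "x \<in> S" and y: "y \<in> L" and \<gamma>: "\<gamma> \<in> \<Gamma>"
    from y consider "y \<in> Q" | z \<alpha> q where "z \<in> S" "\<alpha> \<in> \<Gamma>" "q \<in> Q" "y = m z \<alpha> q"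
      unfolding L_def by blast
    then show "m x \<gamma> y \<in> L"
    proof cases
      case 1
      then show ?thesis unfolding L_def using x \<gamma> by blast
    next
      case 2
      \<comment> \<open>Associativity absorbs \<open>x\<close> into the left factor, so a single
        left multiplier always suffices.\<close>
      then have "m x \<gamma> y = m (m x \<gamma> z) \<alpha> q"
        using assoc x \<gamma> QS by (metis subsetD)
      then show ?thesis
        unfolding L_def using 2 x \<gamma> closed by blast
    qed
  qed
  then obtain \<gamma> where \<gamma>: "\<gamma> \<in> \<Gamma>"
    and eq: "(if a \<in> L then 1 else 0) = (if m a \<gamma> a \<in> L then 1 else (0::real))"
    using sq a by blast
  \<comment> \<open>Whichever \<gamma> was obtained, this square lies in \<open>Q\<close>, so its
    indicator value is 1, and hence so is that of \<open>a\<close>.\<close>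
  have "m a \<gamma> a \<in> L"
    unfolding L_def Q_def using \<gamma> by blast
  with eq have "a \<in> L"
    by (simp split: if_splits)
  moreover have "(\<exists>\<beta>\<in>\<Gamma>. y = m a \<beta> a) \<or> (\<exists>x\<in>S. \<exists>\<alpha>\<in>\<Gamma>. \<exists>\<beta>\<in>\<Gamma>. y = m x \<alpha> (m a \<beta> a))"
    if "y \<in> L" for y
    using that unfolding L_def Q_def by blast
  ultimately consider \<beta> where "\<beta> \<in> \<Gamma>" "a = m a \<beta> a"
    | x \<alpha> \<beta> where "x \<in> S" "\<alpha> \<in> \<Gamma>" "\<beta> \<in> \<Gamma>" "a = m x \<alpha> (m a \<beta> a)"
    by metis
  then show "\<exists>x\<in>S. \<exists>\<alpha>\<in>\<Gamma>. \<exists>\<beta>\<in>\<Gamma>. a = m (m x \<alpha> a) \<beta> a"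
  proof cases
    case 1
    \<comment> \<open>Substituting \<open>a = m a \<beta> a\<close> for its own first factor makes
      \<open>a\<close> itself the witness for \<open>x\<close>, with \<beta> in both places.\<close>
    then have "a = m (m a \<beta> a) \<beta> a" by metis
    then show ?thesis using a 1(1) by (intro bexI)
  next
    case 2
    then have "a = m (m x \<alpha> a) \<beta> a" using assoc a by metis
    then show ?thesis using 2(1-3) by (intro bexI)
  qed
qed

lemma left_regular_iff_fuzzy_left_ideal:
  "left_regular S \<Gamma> m \<longleftrightarrow>
    (\<forall>\<mu>. fuzzy_left_ideal S \<Gamma> m \<mu> \<longrightarrow> (\<forall>a\<in>S. \<exists>\<gamma>\<in>\<Gamma>. \<mu> a = \<mu> (m a \<gamma> a)))"
  by (auto intro: left_regularI dest: fuzzy_left_ideal_square_eq)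

text \<open>Reversing the product turns associativity into the same law read from right to left,
  with the outer elements and the two elements of \<Gamma> interchanged.\<close>

lemma gamma_semigroup_opposite: "gamma_semigroup S \<Gamma> (\<lambda>x \<gamma> y. m y \<gamma> x)"
  using S_nonempty Gamma_nonempty closed assoc by unfold_locales auto

lemma left_regular_opposite:
  "left_regular S \<Gamma> (\<lambda>x \<gamma> y. m y \<gamma> x) \<longleftrightarrow> right_regular S \<Gamma> m"
proof -
  \<comment> \<open>Left regularity of the opposite product unfolds to the right-bracketed form,
    whereas \<open>right_regular\<close> is bracketed to the left.\<close>
  have "m a \<beta> (m a \<alpha> x) = m (m a \<beta> a) \<alpha> x"
    if "a \<in> S" "x \<in> S" "\<alpha> \<in> \<Gamma>" "\<beta> \<in> \<Gamma>" for a x \<alpha> \<beta>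
    using assoc that by simp
  then show ?thesis
    unfolding left_regular_def right_regular_def by (simp cong: bex_cong)
qed

end

lemma fuzzy_left_ideal_opposite:
  "fuzzy_left_ideal S \<Gamma> (\<lambda>x \<gamma> y. m y \<gamma> x) \<mu> \<longleftrightarrow> fuzzy_right_ideal S \<Gamma> m \<mu>"
  unfolding fuzzy_left_ideal_def fuzzy_right_ideal_def by blast

theorem theorem4p18:
  fixes S :: "'a set" and \<Gamma> :: "'g set" and m :: "'a \<Rightarrow> 'g \<Rightarrow> 'a \<Rightarrow> 'a"
  assumes "gamma_semigroup S \<Gamma> m"
  shows "(left_regular S \<Gamma> m \<longleftrightarrow>
      (\<forall>\<mu>. fuzzy_left_ideal S \<Gamma> m \<mu> \<longrightarrow>
        (\<forall>a\<in>S. \<exists>\<gamma>\<in>\<Gamma>. \<mu> a = \<mu> (m a \<gamma> a)))) \<and>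
    (right_regular S \<Gamma> m \<longleftrightarrow>
      (\<forall>\<mu>. fuzzy_right_ideal S \<Gamma> m \<mu> \<longrightarrow>
        (\<forall>a\<in>S. \<exists>\<gamma>\<in>\<Gamma>. \<mu> a = \<mu> (m a \<gamma> a))))"
proof
  interpret gamma_semigroup S \<Gamma> m by fact
  show "left_regular S \<Gamma> m \<longleftrightarrow>
      (\<forall>\<mu>. fuzzy_left_ideal S \<Gamma> m \<mu> \<longrightarrow> (\<forall>a\<in>S. \<exists>\<gamma>\<in>\<Gamma>. \<mu> a = \<mu> (m a \<gamma> a)))"
    by (rule left_regular_iff_fuzzy_left_ideal)
  show "right_regular S \<Gamma> m \<longleftrightarrow>
      (\<forall>\<mu>. fuzzy_right_ideal S \<Gamma> m \<mu> \<longrightarrow> (\<forall>a\<in>S. \<exists>\<gamma>\<in>\<Gamma>. \<mu> a = \<mu> (m a \<gamma> a)))"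
    \<comment> \<open>The square \<open>m a \<gamma> a\<close> is the same for both products, so
      only the regularity and ideal predicates need translating.\<close>
    using gamma_semigroup.left_regular_iff_fuzzy_left_ideal[OF gamma_semigroup_opposite]
    by (simp only: left_regular_opposite fuzzy_left_ideal_opposite)
qed

end
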